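(* Assume the setting described in the context, and for $t\ge0$ let $G_{S}(t)$ be a random variable distributed as $\mathcal N(0,\bar\sigma^2(t))$ with $$\bar\sigma^2(t)=\int_0^t\int_0^t\lambda(s_1)\lambda(s_2)\,\bar F_{s_1}(t-s_1)\,\bar F_{s_2}(t-s_2)\,(s_1\wedge s_2)\,ds_1\,ds_2 .$$ Then for $\alpha\in(0,1)$ there exist two constants $0<c_1<c_2<\infty$ such that for all $t\ge1$, $$c_1\,t^{3-2\alpha}\le\bar\sigma^2(t)\le c_2\,t^{3-2\alpha},$$ while for $\alpha>1$ there exist two constants $0<c_1<c_2<\infty$ such that for all $t\ge1$, $$c_1\,t\le\bar\sigma^2(t)\le c_2\,t .$$
   Context: $\lambda:[0,\infty)\to\mathbb R_+$ is Lipschitz and there are constants $\underline\lambda,\overline\lambda>0$ with $\underline\lambda\le\lambda(t)\le\overline\lambda$ for all $t\ge0$. $\{\nu(s,dr);s\ge0\}$ is a family of probability laws (service time laws) on $[0,\infty)$ with densities, $\nu(s,dr)=\ell_s(r)\,dr$, and there are $\alpha>0$ and constants $c,C>0$ such that for all $r,s>0$: $c\,(r^{-1-\alpha}\wedge1)\le\ell_s(r)\le C\,(r^{-1-\alpha}\wedge1)$ and $\frac{\partial\ell_s(r)}{\partial s}\le C\,(r^{-1-\alpha}\wedge1)$. Set $\bar F_s(r)=\int_r^\infty\ell_s(\tau)\,d\tau$. *)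

theory Defs
  imports "HOL-Probability.Probability"
begin

text \<open>The density of the service time law of an arrival at time s is \<open>l s\<close>.\<close>

definition Fbar :: "(real \<Rightarrow> real \<Rightarrow> real) \<Rightarrow> real \<Rightarrow> real \<Rightarrow> real" where
  "Fbar l s r = (LBINT \<tau>:{r..}. l s \<tau>)"

definition sigma2_bar :: "(real \<Rightarrow> real) \<Rightarrow> (real \<Rightarrow> real \<Rightarrow> real) \<Rightarrow> real \<Rightarrow> real" where
  "sigma2_bar lam l t =
     (LBINT s1:{0..t}. LBINT s2:{0..t}.
        lam s1 * lam s2 * Fbar l s1 (t - s1) * Fbar l s2 (t - s2) * min s1 s2)"

text \<open>The library's \<open>normal_density\<close> takes the standard deviation and is identically 0 when
  that vanishes, so the degenerate law (which occurs at t = 0) is the Dirac measure.\<close>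

definition normal_law :: "real \<Rightarrow> real \<Rightarrow> real measure" where
  "normal_law m v =
     (if v = 0 then return borel m
      else density lborel (\<lambda>x. ennreal (normal_density m (sqrt v) x)))"

end

theory Submission
  imports Defs
begin

text \<open>The bounds on the densities say that \<open>l s r\<close> is comparable to \<open>(1 + r) powr (-1 - \<alpha>)\<close>, so
  \<open>Fbar l s r\<close> is comparable to \<open>(1 + r) powr (-\<alpha>)\<close>. With \<open>\<phi> s = lam s * Fbar l s (t - s)\<close>, the
  double integral of \<open>\<phi> s1 * \<phi> s2 * min s1 s2\<close> is at most \<open>t\<close> times the square of the integral of
  \<open>\<phi>\<close> over \<open>[0, t]\<close>, and at least \<open>t / 2\<close> times the square of its integral over \<open>[t - d, t]\<close>
  for any \<open>d \<le> t / 2\<close>. Taking \<open>d = t / 2\<close> when \<open>\<alpha> < 1\<close> and \<open>d = 1 / 2\<close> when \<open>\<alpha> > 1\<close> gives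
  matching orders. The bounds need \<open>\<phi>\<close> to be integrable, hence measurable; it is continuous on
  \<open>(0, t]\<close> by dominated convergence, because \<open>l\<close> is continuous in \<open>s\<close>.\<close>

section \<open>Shifted powers: pointwise comparison and explicit integrals\<close>

lemma min_powr_lower:
  fixes r a :: real
  assumes "0 < r" "0 \<le> a"
  shows "(1 + r) powr (- a) \<le> min (r powr (- a)) 1"
proof -
  have "(1 + r) powr (- a) \<le> r powr (- a)"
    using assms by (intro powr_mono2') auto
  moreover have "(1 + r) powr (- a) \<le> 1"
    using powr_mono2'[of "- a" 1 "1 + r"] assms by auto
  ultimately show ?thesis by (rule min.boundedI)
qed

text \<open>The right-hand side is \<open>((1 + r) / 2) powr (- a)\<close>. The mean of 1 and
  \<open>r\<close> is at most the larger of the two, and a power with nonpositive exponent is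
  antitone.\<close>

lemma min_powr_upper:
  fixes r a :: real
  assumes "0 < r" "0 \<le> a"
  shows "min (r powr (- a)) 1 \<le> 2 powr a * (1 + r) powr (- a)"
proof -
  have eq: "2 powr a * (1 + r) powr (- a) = ((1 + r) / 2) powr (- a)"
    using assms by (simp add: powr_divide powr_minus divide_simps)
  show ?thesis
  proof (cases "r \<le> 1")
    case True
    have "1 powr (- a) \<le> ((1 + r) / 2) powr (- a)"
      using assms True by (intro powr_mono2') auto
    with eq show ?thesis by simp
  next
    case False
    have "r powr (- a) \<le> ((1 + r) / 2) powr (- a)"
      using assms False by (intro powr_mono2') auto
    with eq show ?thesis by simp
  qed
qed

text \<open>The antiderivative \<open>- ((1 + x) powr (- a) / a)\<close> tends to 0 at infinity
  because \<open>0 < a\<close>. Working first with the nonnegative integral yields integrability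
  along with the value.\<close>

lemma has_bochner_integral_powr_tail:
  fixes r a :: real
  assumes "0 < a" "0 \<le> r"
  shows "has_bochner_integral lborel (\<lambda>x. indicator {r..} x * (1 + x) powr (- 1 - a))
           ((1 + r) powr (- a) / a)"
proof -
  have "(\<integral>\<^sup>+x. ennreal ((1 + x) powr (- 1 - a)) * indicator {r..} x \<partial>lborel)
      = ennreal (0 - (- ((1 + r) powr (- a) / a)))"
  proof (rule nn_integral_FTC_atLeast)
    show "((\<lambda>x. - ((1 + x) powr (- a) / a)) has_real_derivative (1 + x) powr (- 1 - a)) (at x)"
      if "r \<le> x" for x
      using assms that
      by (auto intro!: derivative_eq_intros simp: powr_diff powr_minus divide_simps)
    have "((\<lambda>x. (1 + x) powr (- a)) \<longlongrightarrow> 0) at_top"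
      using assms by (intro tendsto_neg_powr filterlim_tendsto_add_at_top[OF tendsto_const]
          filterlim_ident) auto
    then have "((\<lambda>x. - ((1 + x) powr (- a) / a)) \<longlongrightarrow> - (0 / a)) at_top"
      using assms by (intro tendsto_intros) auto
    then show "((\<lambda>x. - ((1 + x) powr (- a) / a)) \<longlongrightarrow> 0) at_top" by simp
  qed auto
  then show ?thesis
    using assms
    by (intro has_bochner_integral_nn_integral)
      (auto simp: ennreal_mult' ennreal_indicator mult.commute)
qed

text \<open>For \<open>a = 1\<close> the antiderivative would be logarithmic, hence the exclusion.
  The summand \<open>- 1\<close> in the value is the contribution of the endpoint
  \<open>s = t\<close>, where the shifted power equals 1.\<close>

lemma has_bochner_integral_powr_Icc:
  fixes a t :: real
  assumes "a \<noteq> 1" "0 \<le> t"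
  shows "has_bochner_integral lborel (\<lambda>s. indicator {0..t} s * (1 + t - s) powr (- a))
           (((1 + t) powr (1 - a) - 1) / (1 - a))"
proof -
  have "has_bochner_integral lborel (\<lambda>s. indicator {0..t} s *\<^sub>R (1 + t - s) powr (- a))
    (- ((1 + t - t) powr (1 - a) / (1 - a)) - (- ((1 + t - 0) powr (1 - a) / (1 - a))))"
  proof (rule has_bochner_integral_FTC_Icc)
    show "((\<lambda>s. - ((1 + t - s) powr (1 - a) / (1 - a))) has_vector_derivative
            (1 + t - s) powr (- a)) (at s within {0..t})" if "0 \<le> s" "s \<le> t" for s
      unfolding has_real_derivative_iff_has_vector_derivative[symmetric]
      by (rule has_field_derivative_at_within)
        (use assms that in \<open>auto intro!: derivative_eq_intros simp: divide_simps\<close>)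
    show "continuous_on {0..t} (\<lambda>s. (1 + t - s) powr (- a))"
      by (intro continuous_intros) auto
  qed fact
  then show ?thesis by (simp add: diff_divide_distrib)
qed

section \<open>Tails of the service laws: measurability, size and continuity\<close>

text \<open>A density is known to be measurable only on the half-line. As \<open>{r..}\<close> lies
  inside \<open>{0..}\<close>, cutting off at 0 first does not change the product.\<close>

lemma Fbar_integrand_measurable:
  fixes f :: "real \<Rightarrow> real"
  assumes "f \<in> borel_measurable (restrict_space lborel {0..})" "0 \<le> r"
  shows "(\<lambda>x. indicator {r..} x * f x) \<in> borel_measurable lborel"
proof -
  have "(\<lambda>x. indicator {0..} x * f x) \<in> borel_measurable lborel"
    using iffD1[OF borel_measurable_restrict_space_iff assms(1)] unfolding real_scaleR_def by simp
  then have "(\<lambda>x. indicator {r..} x * (indicator {0..} x * f x)) \<in> borel_measurable lborel"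
    by (rule borel_measurable_times[rotated]) simp
  also have "(\<lambda>x. indicator {r..} x * (indicator {0..} x * f x)) = (\<lambda>x. indicator {r..} x * f x)"
    using assms(2) by (auto simp: fun_eq_iff indicator_def)
  finally show ?thesis .
qed

text \<open>The pointwise comparison of \<open>l s\<close> with the shifted power is integrated over
  \<open>{r..}\<close>; the tail integral of that power supplies the factor
  \<open>(1 + r) powr (- a) / a\<close>.\<close>

lemma Fbar_bounds:
  fixes l :: "real \<Rightarrow> real \<Rightarrow> real" and a c C r s :: real
  assumes "0 < a" "0 \<le> r"
    and meas: "l s \<in> borel_measurable (restrict_space lborel {0..})"
    and bounds: "\<And>x. 0 < x \<Longrightarrow>
      0 \<le> l s x \<and> c * (1 + x) powr (- 1 - a) \<le> l s x \<and> l s x \<le> C * (1 + x) powr (- 1 - a)"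
  shows "c / a * (1 + r) powr (- a) \<le> Fbar l s r"
    and "Fbar l s r \<le> C / a * (1 + r) powr (- a)"
proof -
  define h where "h x = indicator {r..} x * (1 + x) powr (- 1 - a)" for x :: real
  define g where "g x = indicator {r..} x * l s x" for x :: real
  have h: "has_bochner_integral lborel h ((1 + r) powr (- a) / a)"
    unfolding h_def using assms by (intro has_bochner_integral_powr_tail)
  \<comment> \<open>For \<open>r = 0\<close> the domain contains the point 0, where
    \<open>bounds\<close> is silent, so the comparison holds only almost everywhere.\<close>
  have ne: "AE x in lborel. x \<noteq> (0::real)"
    by (rule AE_lborel_singleton)
  have b: "AE x in lborel. 0 \<le> g x \<and> c * h x \<le> g x \<and> g x \<le> C * h x"
    using ne
  proof eventually_elim
    case (elim x)
    then show ?case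
      using bounds[of x] \<open>0 \<le> r\<close> by (cases "r \<le> x") (auto simp: g_def h_def)
  qed
  have hI: "integrable lborel h" and hE: "integral\<^sup>L lborel h = (1 + r) powr (- a) / a"
    using h by (auto simp: has_bochner_integral_iff)
  \<comment> \<open>The lower bound on \<open>Fbar\<close> depends on this too: the Bochner integral
    of a nonintegrable function would be 0.\<close>
  have gI: "integrable lborel g"
  proof (rule Bochner_Integration.integrable_bound)
    show "integrable lborel (\<lambda>x. C * h x)" using hI by simp
    show "g \<in> borel_measurable lborel"
      unfolding g_def using Fbar_integrand_measurable[OF meas \<open>0 \<le> r\<close>] .
    show "AE x in lborel. norm (g x) \<le> norm (C * h x)"
      using b by eventually_elim auto
  qed
  have F: "Fbar l s r = integral\<^sup>L lborel g"
    unfolding Fbar_def set_lebesgue_integral_def g_def by simp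
  have "integral\<^sup>L lborel (\<lambda>x. c * h x) \<le> integral\<^sup>L lborel g"
    using b hI gI by (intro integral_mono_AE) auto
  then show "c / a * (1 + r) powr (- a) \<le> Fbar l s r"
    by (simp add: hE F)
  have "integral\<^sup>L lborel g \<le> integral\<^sup>L lborel (\<lambda>x. C * h x)"
    using b hI gI by (intro integral_mono_AE) auto
  then show "Fbar l s r \<le> C / a * (1 + r) powr (- a)"
    by (simp add: hE F)
qed

text \<open>Both the threshold \<open>t - s\<close> and the density vary with \<open>s\<close>.
  Dominated convergence along sequences handles them together, since the majorant does not depend on
  \<open>s\<close>; \<open>s \<le> t\<close> keeps the threshold nonnegative.\<close>

lemma continuous_on_Fbar_diagonal:
  fixes l :: "real \<Rightarrow> real \<Rightarrow> real" and a C t :: real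
  assumes "0 < a"
    and meas: "\<And>s. 0 < s \<Longrightarrow> l s \<in> borel_measurable (restrict_space lborel {0..})"
    and bounds: "\<And>s x. 0 < s \<Longrightarrow> 0 < x \<Longrightarrow> 0 \<le> l s x \<and> l s x \<le> C * (1 + x) powr (- 1 - a)"
    and cont: "\<And>s x. 0 < s \<Longrightarrow> 0 < x \<Longrightarrow> isCont (\<lambda>u. l u x) s"
  shows "continuous_on {0<..t} (\<lambda>s. Fbar l s (t - s))"
  unfolding continuous_on_sequentially
proof (intro allI ballI impI)
  fix u :: "nat \<Rightarrow> real" and s
  assume s: "s \<in> {0<..t}" and "(\<forall>n. u n \<in> {0<..t}) \<and> u \<longlonglongrightarrow> s"
  then have u: "\<And>n. 0 < u n" "\<And>n. u n \<le> t" and lim: "u \<longlonglongrightarrow> s" by auto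
  have "(\<lambda>n. \<integral>x. indicator {t - u n..} x * l (u n) x \<partial>lborel) \<longlonglongrightarrow>
        (\<integral>x. indicator {t - s..} x * l s x \<partial>lborel)"
  proof (rule integral_dominated_convergence)
    show "integrable lborel (\<lambda>x. C * (indicator {0..} x * (1 + x) powr (- 1 - a)))"
      using has_bochner_integral_powr_tail[OF \<open>0 < a\<close>, of 0]
      by (auto simp: has_bochner_integral_iff)
    show "(\<lambda>x. indicator {t - s..} x * l s x) \<in> borel_measurable lborel"
      using s meas[of s] by (intro Fbar_integrand_measurable) auto
    show "(\<lambda>x. indicator {t - u n..} x * l (u n) x) \<in> borel_measurable lborel" for n
      using u[of n] meas[of "u n"] by (intro Fbar_integrand_measurable) auto
    \<comment> \<open>Two null points are discarded: 0, where there is no bound, and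
      \<open>t - s\<close>, where the indicators may oscillate.\<close>
    have ne: "AE x in lborel. x \<noteq> (0::real)" "AE x in lborel. x \<noteq> t - s"
      by (rule AE_lborel_singleton)+
    show "AE x in lborel. (\<lambda>n. indicator {t - u n..} x * l (u n) x) \<longlonglongrightarrow>
        indicator {t - s..} x * l s x"
      using ne
    proof eventually_elim
      case (elim x)
      have lim': "(\<lambda>n. t - u n) \<longlonglongrightarrow> t - s" by (intro tendsto_intros lim)
      show ?case
      \<comment> \<open>Away from the limiting threshold the indicator is eventually constant: 0
        below it, and 1 above it, where only the continuity of \<open>l\<close> in its first
        argument remains.\<close>
      proof (cases "x < t - s")
        case True
        have "eventually (\<lambda>n. x < t - u n) sequentially"
          using order_tendstoD(1)[OF lim' True] .
        then have "eventually (\<lambda>n. indicator {t - u n..} x * l (u n) x = 0) sequentially"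
          by eventually_elim auto
        with True show ?thesis by (simp add: tendsto_eventually)
      next
        case False
        with elim have *: "t - s < x" by auto
        have x: "0 < x" using * s by auto
        have "eventually (\<lambda>n. t - u n < x) sequentially"
          using order_tendstoD(2)[OF lim' *] .
        then have "eventually (\<lambda>n. l (u n) x = indicator {t - u n..} x * l (u n) x) sequentially"
          by eventually_elim auto
        moreover have "(\<lambda>n. l (u n) x) \<longlonglongrightarrow> l s x"
          using isCont_tendsto_compose[OF cont lim] s x by auto
        ultimately show ?thesis
          using * by (auto intro: Lim_transform_eventually)
      qed
    qed
    show "AE x in lborel. norm (indicator {t - u n..} x * l (u n) x)
        \<le> C * (indicator {0..} x * (1 + x) powr (- 1 - a))" for n
      using ne(1)
    proof eventually_elim
      case (elim x)
      show ?case
      proof (cases "0 < x")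
        case True
        with bounds[OF u(1)[of n] True] show ?thesis
          by (auto simp: indicator_def split: if_splits)
      next
        case False
        with elim have "x < 0" by auto
        with u(2)[of n] show ?thesis by (auto simp: indicator_def)
      qed
    qed
  qed
  then show "((\<lambda>s. Fbar l s (t - s)) \<circ> u) \<longlonglongrightarrow> Fbar l s (t - s)"
    by (simp add: Fbar_def set_lebesgue_integral_def o_def)
qed

section \<open>Double integrals with kernel \<open>min x y\<close>\<close>

text \<open>On the support \<open>min x y \<le> t\<close>. On the square with side
  \<open>{t - d..t}\<close> one has \<open>min x y \<ge> t - d \<ge> t / 2\<close>, and the
  nonnegative remainder outside that square is dropped.\<close>

lemma double_integral_min_bounds:
  fixes \<phi> :: "real \<Rightarrow> real" and d t :: real
  assumes int: "integrable lborel \<phi>" and nonneg: "\<And>s. 0 \<le> \<phi> s"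
    and support: "\<And>s. s \<notin> {0..t} \<Longrightarrow> \<phi> s = 0"
    and d: "0 \<le> d" "d \<le> t / 2"
  defines "I \<equiv> \<integral>x. \<integral>y. \<phi> x * \<phi> y * min x y \<partial>lborel \<partial>lborel"
  shows "I \<le> t * (integral\<^sup>L lborel \<phi>)\<^sup>2"
    and "t / 2 * (\<integral>x. indicator {t - d..t} x * \<phi> x \<partial>lborel)\<^sup>2 \<le> I"
proof -
  have [measurable]: "\<phi> \<in> borel_measurable borel"
    using int by (auto dest: borel_measurable_integrable)
  define \<psi> where "\<psi> x = indicator {t - d..t} x * \<phi> x" for x
  have psi_int: "integrable lborel \<psi>"
    unfolding \<psi>_def using integrable_mult_indicator[OF _ int, of "{t - d..t}"] by simp
  have k: "0 \<le> \<phi> x * \<phi> y * min x y" "\<phi> x * \<phi> y * min x y \<le> t * \<phi> x * \<phi> y" for x y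
  proof -
    consider "x \<notin> {0..t}" | "y \<notin> {0..t}" | "x \<in> {0..t}" "y \<in> {0..t}" by blast
    then have "0 \<le> \<phi> x * \<phi> y * min x y \<and> \<phi> x * \<phi> y * min x y \<le> t * \<phi> x * \<phi> y"
    proof cases
      case 3
      then have "\<phi> x * \<phi> y * min x y \<le> \<phi> x * \<phi> y * t"
        using nonneg by (intro mult_left_mono) auto
      with 3 nonneg show ?thesis by (auto simp: mult_ac)
    qed (simp_all add: support)
    then show "0 \<le> \<phi> x * \<phi> y * min x y" "\<phi> x * \<phi> y * min x y \<le> t * \<phi> x * \<phi> y" by auto
  qed
  have k2: "t / 2 * \<psi> x * \<psi> y \<le> \<phi> x * \<phi> y * min x y" for x y
  proof (cases "x \<in> {t - d..t} \<and> y \<in> {t - d..t}")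
    case True
    then have "\<phi> x * \<phi> y * (t / 2) \<le> \<phi> x * \<phi> y * min x y"
      using nonneg d by (intro mult_left_mono) auto
    with True show ?thesis by (auto simp: \<psi>_def mult_ac)
  next
    case False
    then have "\<psi> x * \<psi> y = 0" by (auto simp: \<psi>_def)
    with k(1)[of x y] show ?thesis by auto
  qed
  \<comment> \<open>The inner integral is bounded pointwise by multiples of \<open>\<phi> x\<close>
    and \<open>\<psi> x\<close>, and these bounds are integrated once more. Fubini is thus avoided,
    at the price of checking integrability at both levels.\<close>
  define J where "J x = (\<integral>y. \<phi> x * \<phi> y * min x y \<partial>lborel)" for x
  have inner: "integrable lborel (\<lambda>y. \<phi> x * \<phi> y * min x y)" for x
  proof (rule Bochner_Integration.integrable_bound)
    show "integrable lborel (\<lambda>y. t * \<phi> x * \<phi> y)" using int by simp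
    show "AE y in lborel. norm (\<phi> x * \<phi> y * min x y) \<le> norm (t * \<phi> x * \<phi> y)"
      using k[of x] by (intro AE_I2) (metis abs_of_nonneg order_trans real_norm_def)
  qed measurable
  have J_nonneg: "0 \<le> J x" for x
    unfolding J_def using k(1) by (intro integral_nonneg_AE) auto
  have J_upper: "J x \<le> t * integral\<^sup>L lborel \<phi> * \<phi> x" for x
  proof -
    have "J x \<le> (\<integral>y. t * \<phi> x * \<phi> y \<partial>lborel)"
      unfolding J_def using inner k(2) int by (intro integral_mono) auto
    then show ?thesis by (simp add: mult_ac)
  qed
  have J_lower: "t / 2 * integral\<^sup>L lborel \<psi> * \<psi> x \<le> J x" for x
  proof -
    have "(\<integral>y. t / 2 * \<psi> x * \<psi> y \<partial>lborel) \<le> J x"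
      unfolding J_def using inner k2 psi_int
      by (intro integral_mono) (auto intro!: integrable_mult_right)
    then show ?thesis by (simp add: mult_ac)
  qed
  have J_int: "integrable lborel J"
  proof (rule Bochner_Integration.integrable_bound)
    show "integrable lborel (\<lambda>x. t * integral\<^sup>L lborel \<phi> * \<phi> x)"
      using int by (intro integrable_mult_right)
    show "J \<in> borel_measurable lborel"
      unfolding J_def by measurable
    show "AE x in lborel. norm (J x) \<le> norm (t * integral\<^sup>L lborel \<phi> * \<phi> x)"
      using J_nonneg J_upper by (intro AE_I2) (metis abs_of_nonneg order_trans real_norm_def)
  qed
  have I: "I = integral\<^sup>L lborel J" unfolding I_def J_def ..
  have "I \<le> (\<integral>x. t * integral\<^sup>L lborel \<phi> * \<phi> x \<partial>lborel)"
    unfolding I using J_int J_upper int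
    by (intro integral_mono) (auto intro!: integrable_mult_right)
  then show "I \<le> t * (integral\<^sup>L lborel \<phi>)\<^sup>2" by (simp add: power2_eq_square mult_ac)
  have "(\<integral>x. t / 2 * integral\<^sup>L lborel \<psi> * \<psi> x \<partial>lborel) \<le> I"
    unfolding I using J_int J_lower psi_int
    by (intro integral_mono) (auto intro!: integrable_mult_right)
  then have "t / 2 * (integral\<^sup>L lborel \<psi>)\<^sup>2 \<le> I" by (simp add: power2_eq_square mult_ac)
  then show "t / 2 * (\<integral>x. indicator {t - d..t} x * \<phi> x \<partial>lborel)\<^sup>2 \<le> I"
    unfolding \<psi>_def .
qed

text \<open>The upper bound inserts the closed form of the integral of the shifted power. For the
  lower bound, \<open>1 + t - s \<le> 1 + d\<close> on \<open>{t - d..t}\<close>, an interval of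
  length \<open>d\<close>, so \<open>\<phi>\<close> is at least a constant there.\<close>

lemma double_integral_min_powr_bounds:
  fixes \<phi> :: "real \<Rightarrow> real" and a b B d t :: real
  assumes meas: "\<phi> \<in> borel_measurable lborel" and "a \<noteq> 1" "0 < a" "0 < b"
    and bounds: "\<And>s. s \<in> {0<..t} \<Longrightarrow>
      b * (1 + t - s) powr (- a) \<le> \<phi> s \<and> \<phi> s \<le> B * (1 + t - s) powr (- a)"
    and support: "\<And>s. s \<notin> {0<..t} \<Longrightarrow> \<phi> s = 0"
    and d: "0 < d" "d \<le> t / 2"
  defines "I \<equiv> \<integral>x. \<integral>y. \<phi> x * \<phi> y * min x y \<partial>lborel \<partial>lborel"
  shows "I \<le> t * (B * (((1 + t) powr (1 - a) - 1) / (1 - a)))\<^sup>2"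
    and "t / 2 * (d * (b * (1 + d) powr (- a)))\<^sup>2 \<le> I"
proof -
  define h where "h s = indicator {0..t} s * (1 + t - s) powr (- a)" for s
  have hI: "integrable lborel h"
    and hE: "integral\<^sup>L lborel h = ((1 + t) powr (1 - a) - 1) / (1 - a)"
    using has_bochner_integral_powr_Icc[of a t] assms
    by (auto simp: h_def[abs_def] has_bochner_integral_iff)
  have nonneg: "0 \<le> \<phi> s" for s
  proof (cases "s \<in> {0<..t}")
    case True
    have "0 \<le> b * (1 + t - s) powr (- a)" using \<open>0 < b\<close> by simp
    with bounds[OF True] show ?thesis by linarith
  qed (simp add: support)
  \<comment> \<open>At \<open>s = t\<close> the power equals 1, so \<open>\<phi> t \<le> B\<close>.
    The sign is used at \<open>s = 0\<close>, where \<open>\<phi>\<close> vanishes but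
    \<open>h\<close> does not.\<close>
  have B: "0 \<le> B"
  proof -
    have "0 \<le> \<phi> t" "\<phi> t \<le> B" using nonneg bounds[of t] d by auto
    then show ?thesis by simp
  qed
  have upper: "\<phi> s \<le> B * h s" for s
    using bounds[of s] support[of s] B by (cases "s \<in> {0<..t}") (auto simp: h_def)
  have int: "integrable lborel \<phi>"
  proof (rule Bochner_Integration.integrable_bound)
    show "integrable lborel (\<lambda>s. B * h s)" using hI by simp
    show "AE x in lborel. norm (\<phi> x) \<le> norm (B * h x)"
      using nonneg upper by (intro AE_I2) (metis abs_of_nonneg order_trans real_norm_def)
  qed fact
  have supp': "\<phi> s = 0" if "s \<notin> {0..t}" for s
    using support[of s] that by auto
  note DB = double_integral_min_bounds[OF int nonneg supp' less_imp_le[OF d(1)] d(2)]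
  have "integral\<^sup>L lborel \<phi> \<le> (\<integral>s. B * h s \<partial>lborel)"
    using int hI upper by (intro integral_mono) auto
  then have le: "integral\<^sup>L lborel \<phi> \<le> B * (((1 + t) powr (1 - a) - 1) / (1 - a))"
    using hE by simp
  have "0 \<le> integral\<^sup>L lborel \<phi>" using nonneg by simp
  then have "t * (integral\<^sup>L lborel \<phi>)\<^sup>2 \<le> t * (B * (((1 + t) powr (1 - a) - 1) / (1 - a)))\<^sup>2"
    using le d by (intro mult_left_mono power_mono) auto
  with DB(1) show "I \<le> t * (B * (((1 + t) powr (1 - a) - 1) / (1 - a)))\<^sup>2"
    unfolding I_def by linarith
  have "(\<integral>x. indicator {t - d..t} x * (b * (1 + d) powr (- a)) \<partial>lborel)
      \<le> (\<integral>x. indicator {t - d..t} x * \<phi> x \<partial>lborel)"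
  proof (rule integral_mono)
    show "integrable lborel (\<lambda>x. indicator {t - d..t} x * \<phi> x)"
      using integrable_mult_indicator[OF _ int, of "{t - d..t}"] by simp
    show "integrable lborel (\<lambda>x. indicator {t - d..t} x * (b * (1 + d) powr (- a)))"
      by (intro integrable_mult_left integrable_real_indicator) (auto simp: emeasure_lborel_Icc_eq)
    show "indicator {t - d..t} x * (b * (1 + d) powr (- a)) \<le> indicator {t - d..t} x * \<phi> x" for x
    proof (cases "x \<in> {t - d..t}")
      case True
      have "b * (1 + d) powr (- a) \<le> b * (1 + t - x) powr (- a)"
        using True \<open>0 < a\<close> \<open>0 < b\<close> by (intro mult_left_mono powr_mono2') auto
      also have "\<dots> \<le> \<phi> x" using bounds[of x] True d by auto
      finally show ?thesis using True by simp
    qed simp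
  qed
  then have "d * (b * (1 + d) powr (- a)) \<le> (\<integral>x. indicator {t - d..t} x * \<phi> x \<partial>lborel)"
    using d by simp
  then have "t / 2 * (d * (b * (1 + d) powr (- a)))\<^sup>2
      \<le> t / 2 * (\<integral>x. indicator {t - d..t} x * \<phi> x \<partial>lborel)\<^sup>2"
    using d \<open>0 < b\<close> by (intro mult_left_mono power_mono) auto
  with DB(2) show "t / 2 * (d * (b * (1 + d) powr (- a)))\<^sup>2 \<le> I"
    unfolding I_def by linarith
qed

section \<open>The variance as an integral over the whole plane\<close>

lemma sigma2_bar_eq:
  fixes lam :: "real \<Rightarrow> real" and l :: "real \<Rightarrow> real \<Rightarrow> real" and t :: real
  defines "\<phi> \<equiv> \<lambda>s. indicator {0<..t} s * (lam s * Fbar l s (t - s))"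
  shows "sigma2_bar lam l t = (\<integral>x. \<integral>y. \<phi> x * \<phi> y * min x y \<partial>lborel \<partial>lborel)"
proof -
  text \<open>The density at time 0 is not controlled, but the factor \<open>min s1 s2\<close> vanishes there.\<close>
  have "indicator {0..t} x * (indicator {0..t} y *
          (lam x * lam y * Fbar l x (t - x) * Fbar l y (t - y) * min x y))
      = \<phi> x * \<phi> y * min x y" for x y
    unfolding \<phi>_def by (auto simp: indicator_def min_def)
  moreover have "sigma2_bar lam l t =
    (\<integral>x. \<integral>y. indicator {0..t} x * (indicator {0..t} y *
       (lam x * lam y * Fbar l x (t - x) * Fbar l y (t - y) * min x y)) \<partial>lborel \<partial>lborel)"
    unfolding sigma2_bar_def set_lebesgue_integral_def real_scaleR_def
    by (simp only: integral_mult_right_zero)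
  ultimately show ?thesis by (simp only:)
qed

section \<open>Growth of the variance\<close>

theorem proposition4p8:
  fixes lam :: "real \<Rightarrow> real" and lam_lo lam_hi :: real
    and \<nu> :: "real \<Rightarrow> real measure" and l :: "real \<Rightarrow> real \<Rightarrow> real"
    and \<alpha> c C :: real
    and M :: "'w measure" and G\<^sub>S :: "real \<Rightarrow> 'w \<Rightarrow> real"
  assumes lam_lipschitz: "\<exists>L. L-lipschitz_on {0..} lam"
    and lam_lo_pos: "0 < lam_lo" and lam_hi_pos: "0 < lam_hi"
    and lam_bounds: "\<And>t. 0 \<le> t \<Longrightarrow> lam_lo \<le> lam t \<and> lam t \<le> lam_hi"
    and nu_prob: "\<And>s. 0 \<le> s \<Longrightarrow> prob_space (\<nu> s)"
    and l_measurable: "\<And>s. 0 \<le> s \<Longrightarrow> l s \<in> borel_measurable (restrict_space lborel {0..})"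
    and l_nonneg: "\<And>s r. 0 \<le> s \<Longrightarrow> 0 \<le> r \<Longrightarrow> 0 \<le> l s r"
    and nu_density: "\<And>s. 0 \<le> s \<Longrightarrow>
          \<nu> s = density (restrict_space lborel {0..}) (\<lambda>r. ennreal (l s r))"
    and alpha_pos: "0 < \<alpha>" and c_pos: "0 < c" and C_pos: "0 < C"
    and l_bounds: "\<And>r s. 0 < r \<Longrightarrow> 0 < s \<Longrightarrow>
          c * min (r powr (- 1 - \<alpha>)) 1 \<le> l s r \<and> l s r \<le> C * min (r powr (- 1 - \<alpha>)) 1"
    and l_differentiable: "\<And>r s. 0 < r \<Longrightarrow> 0 < s \<Longrightarrow> (\<lambda>u. l u r) differentiable (at s)"
    and l_deriv_bound: "\<And>r s. 0 < r \<Longrightarrow> 0 < s \<Longrightarrow>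
          deriv (\<lambda>u. l u r) s \<le> C * min (r powr (- 1 - \<alpha>)) 1"
    and M_prob: "prob_space M"
    and G_random_variable: "\<And>t. 0 \<le> t \<Longrightarrow> G\<^sub>S t \<in> borel_measurable M"
    and G_law: "\<And>t. 0 \<le> t \<Longrightarrow> distr M borel (G\<^sub>S t) = normal_law 0 (sigma2_bar lam l t)"
  shows "(\<alpha> \<in> {0<..<1} \<longrightarrow>
            (\<exists>c1 c2. 0 < c1 \<and> c1 < c2 \<and>
              (\<forall>t\<ge>1. c1 * t powr (3 - 2 * \<alpha>) \<le> sigma2_bar lam l t \<and>
                     sigma2_bar lam l t \<le> c2 * t powr (3 - 2 * \<alpha>))))
       \<and> (\<alpha> > 1 \<longrightarrow>
            (\<exists>c1 c2. 0 < c1 \<and> c1 < c2 \<and>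
              (\<forall>t\<ge>1. c1 * t \<le> sigma2_bar lam l t \<and> sigma2_bar lam l t \<le> c2 * t)))"
proof -
  \<comment> \<open>These are products of the bounds for \<open>lam\<close> and for
    \<open>Fbar\<close>. The factor \<open>2 powr (1 + \<alpha>)\<close> is the cost of replacing
    the truncated power by the shifted one in the upper bound.\<close>
  define b where "b = lam_lo * (c / \<alpha>)"
  define B where "B = lam_hi * (C * 2 powr (1 + \<alpha>) / \<alpha>)"
  have b: "0 < b" using lam_lo_pos c_pos alpha_pos by (simp add: b_def)
  have B: "0 < B" using lam_hi_pos C_pos alpha_pos by (simp add: B_def)
  have l_lower: "c * (1 + r) powr (- 1 - \<alpha>) \<le> l s r"
    and l_upper: "l s r \<le> C * 2 powr (1 + \<alpha>) * (1 + r) powr (- 1 - \<alpha>)"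
    if "0 < s" "0 < r" for s r
  proof -
    have *: "- (1 + \<alpha>) = - 1 - \<alpha>" by simp
    have "c * (1 + r) powr (- 1 - \<alpha>) \<le> c * min (r powr (- 1 - \<alpha>)) 1"
      using min_powr_lower[of r "1 + \<alpha>"] that alpha_pos c_pos unfolding *
      by (intro mult_left_mono) auto
    then show "c * (1 + r) powr (- 1 - \<alpha>) \<le> l s r"
      using l_bounds[OF that(2,1)] by linarith
    have "C * min (r powr (- 1 - \<alpha>)) 1 \<le> C * (2 powr (1 + \<alpha>) * (1 + r) powr (- 1 - \<alpha>))"
      using min_powr_upper[of r "1 + \<alpha>"] that alpha_pos C_pos unfolding *
      by (intro mult_left_mono) auto
    then show "l s r \<le> C * 2 powr (1 + \<alpha>) * (1 + r) powr (- 1 - \<alpha>)"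
      using l_bounds[OF that(2,1)] by (simp add: mult.assoc)
  qed
  have bounds: "sigma2_bar lam l t \<le> t * (B * (((1 + t) powr (1 - \<alpha>) - 1) / (1 - \<alpha>)))\<^sup>2"
    "t / 2 * (d * (b * (1 + d) powr (- \<alpha>)))\<^sup>2 \<le> sigma2_bar lam l t"
    if "\<alpha> \<noteq> 1" "0 < d" "d \<le> t / 2" for d t
  proof -
    define \<phi> where "\<phi> s = indicator {0<..t} s * (lam s * Fbar l s (t - s))" for s
    have F: "c / \<alpha> * (1 + t - s) powr (- \<alpha>) \<le> Fbar l s (t - s)"
      "Fbar l s (t - s) \<le> C * 2 powr (1 + \<alpha>) / \<alpha> * (1 + t - s) powr (- \<alpha>)"
      if "s \<in> {0<..t}" for s
      using Fbar_bounds[of \<alpha> "t - s" l s c "C * 2 powr (1 + \<alpha>)"] that alpha_pos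
        l_measurable[of s] l_nonneg[of s] l_lower[of s] l_upper[of s]
      by (auto simp: add_diff_eq)
    have phi_bounds: "b * (1 + t - s) powr (- \<alpha>) \<le> \<phi> s \<and> \<phi> s \<le> B * (1 + t - s) powr (- \<alpha>)"
      if "s \<in> {0<..t}" for s
    proof -
      have lam: "lam_lo \<le> lam s" "lam s \<le> lam_hi" using lam_bounds[of s] that by auto
      have low: "0 \<le> c / \<alpha> * (1 + t - s) powr (- \<alpha>)"
        using c_pos alpha_pos by simp
      have "lam_lo * (c / \<alpha> * (1 + t - s) powr (- \<alpha>)) \<le> lam s * Fbar l s (t - s)"
        using lam F[OF that] lam_lo_pos low by (intro mult_mono) auto
      moreover have "lam s * Fbar l s (t - s)
          \<le> lam_hi * (C * 2 powr (1 + \<alpha>) / \<alpha> * (1 + t - s) powr (- \<alpha>))"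
        using lam F[OF that] lam_hi_pos low by (intro mult_mono) auto
      ultimately show ?thesis using that by (simp add: \<phi>_def b_def B_def mult.assoc)
    qed
    have "continuous_on {0..} lam"
      using lam_lipschitz by (auto intro: lipschitz_on_continuous_on)
    then have "continuous_on {0<..t} lam"
      by (rule continuous_on_subset) auto
    \<comment> \<open>Differentiability of the densities in \<open>s\<close> supplies the continuity
      needed for dominated convergence.\<close>
    moreover have "continuous_on {0<..t} (\<lambda>s. Fbar l s (t - s))"
      using alpha_pos l_measurable l_nonneg l_upper
        differentiable_imp_continuous_within[OF l_differentiable]
      by (intro continuous_on_Fbar_diagonal[where a = \<alpha> and C = "C * 2 powr (1 + \<alpha>)"]) auto
    ultimately have "continuous_on {0<..t} (\<lambda>s. lam s * Fbar l s (t - s))"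
      by (intro continuous_intros)
    then have "\<phi> \<in> borel_measurable borel"
      unfolding \<phi>_def
      using borel_measurable_continuous_on_indicator[of "{0<..t}" "\<lambda>s. lam s * Fbar l s (t - s)"]
      by simp
    then have meas: "\<phi> \<in> borel_measurable lborel" by simp
    have supp: "\<phi> s = 0" if "s \<notin> {0<..t}" for s using that by (simp add: \<phi>_def)
    show "sigma2_bar lam l t \<le> t * (B * (((1 + t) powr (1 - \<alpha>) - 1) / (1 - \<alpha>)))\<^sup>2"
      "t / 2 * (d * (b * (1 + d) powr (- \<alpha>)))\<^sup>2 \<le> sigma2_bar lam l t"
      using double_integral_min_powr_bounds[OF meas that(1) alpha_pos b phi_bounds supp that(2,3)]
      unfolding sigma2_bar_eq \<phi>_def by auto
  qed
  \<comment> \<open>The strict inequality \<open>c1 < c2\<close> is obtained by enlarging the upper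
    constant to \<open>max k2 (k1 + 1)\<close>, which is harmless because \<open>g\<close> is
    nonnegative.\<close>
  have combine: "\<exists>c1 c2. 0 < c1 \<and> c1 < c2 \<and>
      (\<forall>t\<ge>1. c1 * g t \<le> sigma2_bar lam l t \<and> sigma2_bar lam l t \<le> c2 * g t)"
    if k: "0 < k1" "\<And>t. 1 \<le> t \<Longrightarrow> 0 \<le> g t"
      "\<And>t. 1 \<le> t \<Longrightarrow> k1 * g t \<le> sigma2_bar lam l t"
      "\<And>t. 1 \<le> t \<Longrightarrow> sigma2_bar lam l t \<le> k2 * g t" for k1 k2 and g :: "real \<Rightarrow> real"
  proof -
    have "sigma2_bar lam l t \<le> max k2 (k1 + 1) * g t" if t: "1 \<le> t" for t
    proof -
      have "k2 * g t \<le> max k2 (k1 + 1) * g t"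
        using k(2)[OF t] by (intro mult_right_mono) auto
      with k(4)[OF t] show ?thesis by linarith
    qed
    moreover have "k1 < max k2 (k1 + 1)" by linarith
    ultimately show ?thesis
      using k(1,3) by blast
  qed
  show ?thesis
  proof (intro conjI impI)

    \<comment> \<open>Heavy tails: the case \<alpha> < 1\<close>
    assume "\<alpha> \<in> {0<..<1}"
    then have a: "0 < \<alpha>" "\<alpha> < 1" by auto
    have t3: "t * (t powr (1 - \<alpha>))\<^sup>2 = t powr (3 - 2 * \<alpha>)" if "1 \<le> t" for t
    proof -
      have "t * (t powr (1 - \<alpha>))\<^sup>2 = t powr 1 * (t powr (1 - \<alpha>) * t powr (1 - \<alpha>))"
        using that by (simp add: power2_eq_square)
      also have "\<dots> = t powr (3 - 2 * \<alpha>)"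
        by (simp only: powr_add[symmetric]) (simp add: algebra_simps)
      finally show ?thesis .
    qed
    show "\<exists>c1 c2. 0 < c1 \<and> c1 < c2 \<and>
      (\<forall>t\<ge>1. c1 * t powr (3 - 2 * \<alpha>) \<le> sigma2_bar lam l t \<and>
             sigma2_bar lam l t \<le> c2 * t powr (3 - 2 * \<alpha>))"
    proof (rule combine)
      \<comment> \<open>With \<open>d = t / 2\<close> and \<open>1 + t / 2 \<le> 2 * t\<close>, the
        quantity to be squared is at least
        \<open>b * 2 powr (- \<alpha>) / 2 * t powr (1 - \<alpha>)\<close>; the last division by 2
        comes from the outer factor \<open>t / 2\<close>.\<close>
      show "0 < (b * 2 powr (- \<alpha>) / 2)\<^sup>2 / 2" using b by simp
      fix t :: real assume t: "1 \<le> t"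
      show "0 \<le> t powr (3 - 2 * \<alpha>)" by simp
      have "(2 * t) powr (- \<alpha>) \<le> (1 + t / 2) powr (- \<alpha>)"
        using t a by (intro powr_mono2') auto
      then have "t / 2 * (b * (2 * t) powr (- \<alpha>)) \<le> t / 2 * (b * (1 + t / 2) powr (- \<alpha>))"
        using t b by (intro mult_left_mono) auto
      then have "t / 2 * (t / 2 * (b * (2 * t) powr (- \<alpha>)))\<^sup>2
          \<le> t / 2 * (t / 2 * (b * (1 + t / 2) powr (- \<alpha>)))\<^sup>2"
        using t b by (intro mult_left_mono power_mono) auto
      also have "\<dots> \<le> sigma2_bar lam l t" using bounds(2)[of "t / 2" t] t a by auto
      also have "t / 2 * (b * (2 * t) powr (- \<alpha>)) = b * 2 powr (- \<alpha>) / 2 * t powr (1 - \<alpha>)"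
        using t by (simp add: powr_mult powr_diff powr_minus divide_simps)
      also have "t / 2 * (b * 2 powr (- \<alpha>) / 2 * t powr (1 - \<alpha>))\<^sup>2
          = (b * 2 powr (- \<alpha>) / 2)\<^sup>2 / 2 * t powr (3 - 2 * \<alpha>)"
        unfolding t3[OF t, symmetric] power_mult_distrib by simp
      finally show "(b * 2 powr (- \<alpha>) / 2)\<^sup>2 / 2 * t powr (3 - 2 * \<alpha>) \<le> sigma2_bar lam l t" .
      have "(1 + t) powr (1 - \<alpha>) - 1 \<le> (2 * t) powr (1 - \<alpha>)"
        using powr_mono2[of "1 - \<alpha>" "1 + t" "2 * t"] t a by auto
      also have "\<dots> = 2 powr (1 - \<alpha>) * t powr (1 - \<alpha>)"
        using t by (simp add: powr_mult)
      finally have *: "(1 + t) powr (1 - \<alpha>) - 1 \<le> 2 powr (1 - \<alpha>) * t powr (1 - \<alpha>)" .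
      \<comment> \<open>This makes the smaller base nonnegative, as monotonicity of squaring
        requires.\<close>
      have "1 \<le> (1 + t) powr (1 - \<alpha>)"
        using t a by (intro ge_one_powr_ge_zero) auto
      then have "(B * (((1 + t) powr (1 - \<alpha>) - 1) / (1 - \<alpha>)))\<^sup>2
          \<le> (B * (2 powr (1 - \<alpha>) * t powr (1 - \<alpha>) / (1 - \<alpha>)))\<^sup>2"
        using * B a by (intro power_mono mult_left_mono divide_right_mono) auto
      then have "t * (B * (((1 + t) powr (1 - \<alpha>) - 1) / (1 - \<alpha>)))\<^sup>2
          \<le> t * (B * (2 powr (1 - \<alpha>) * t powr (1 - \<alpha>) / (1 - \<alpha>)))\<^sup>2"
        using t by (intro mult_left_mono) auto
      also have "\<dots> = (B * 2 powr (1 - \<alpha>) / (1 - \<alpha>))\<^sup>2 * t powr (3 - 2 * \<alpha>)"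
        unfolding t3[OF t, symmetric] by (simp add: power_mult_distrib power_divide)
      finally show "sigma2_bar lam l t \<le> (B * 2 powr (1 - \<alpha>) / (1 - \<alpha>))\<^sup>2 * t powr (3 - 2 * \<alpha>)"
        using bounds(1)[of "t / 2" t] t a by auto
    qed
  next

    \<comment> \<open>Integrable tails: the case \<alpha> > 1\<close>
    assume a: "1 < \<alpha>"
    show "\<exists>c1 c2. 0 < c1 \<and> c1 < c2 \<and>
      (\<forall>t\<ge>1. c1 * t \<le> sigma2_bar lam l t \<and> sigma2_bar lam l t \<le> c2 * t)"
    proof (rule combine)
      \<comment> \<open>The value \<open>d = 1 / 2\<close> is the largest constant with
        \<open>d \<le> t / 2\<close> for every \<open>t \<ge> 1\<close>.\<close>
      show "0 < (1 / 2 * (b * (1 + 1 / 2) powr (- \<alpha>)))\<^sup>2 / 2" using b by simp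
      fix t :: real assume t: "1 \<le> t"
      show "0 \<le> t" using t by simp
      show "(1 / 2 * (b * (1 + 1 / 2) powr (- \<alpha>)))\<^sup>2 / 2 * t \<le> sigma2_bar lam l t"
        using bounds(2)[of "1 / 2" t] t a by (simp add: mult_ac)
      \<comment> \<open>Numerator and denominator both change sign, which shows that the quotient is
        nonnegative before squaring. It is at most \<open>1 / (\<alpha> - 1)\<close> because the
        power is nonnegative, a bound uniform in \<open>t\<close>.\<close>
      have "((1 + t) powr (1 - \<alpha>) - 1) / (1 - \<alpha>) = (1 - (1 + t) powr (1 - \<alpha>)) / (\<alpha> - 1)"
        by (metis minus_diff_eq minus_divide_divide)
      moreover have "(1 + t) powr (1 - \<alpha>) \<le> 1"
        using powr_mono2'[of "\<alpha> - 1" 1 "1 + t"] powr_mono[of "1 - \<alpha>" 0 "1 + t"] t a by auto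
      ultimately have "(B * (((1 + t) powr (1 - \<alpha>) - 1) / (1 - \<alpha>)))\<^sup>2 \<le> (B * (1 / (\<alpha> - 1)))\<^sup>2"
        using a B by (auto intro!: power_mono mult_left_mono divide_right_mono)
      then have "t * (B * (((1 + t) powr (1 - \<alpha>) - 1) / (1 - \<alpha>)))\<^sup>2 \<le> t * (B * (1 / (\<alpha> - 1)))\<^sup>2"
        using t by (intro mult_left_mono) auto
      then show "sigma2_bar lam l t \<le> (B * (1 / (\<alpha> - 1)))\<^sup>2 * t"
        using bounds(1)[of "t / 2" t] t a unfolding mult.commute[of _ t] by linarith
    qed
  qed
qed


end
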